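(* Let $\varepsilon>0$ be a constant. Any $\left(\tau_1, (3/4-\varepsilon)n\right)$-strategy of Builder fails, with probability at least $\frac{\varepsilon^3}{100}$, in building a graph with minimum degree at least $1$.
   Context: Let $V=[n]$ ($n$ sufficiently large), $N=\binom{n}{2}$, and let $e_1,\dots,e_N$ be a uniformly random permutation of the edges of the complete graph $K_n$ on $V$; $\mathbf{G}_{n,m}$ denotes the graph on $V$ with edge set $\{e_1,\dots,e_m\}$ (the random graph process). A player, Builder, sees the edges $e_1,e_2,\dots$ one by one and must decide irrevocably upon seeing $e_i$ whether to purchase it; her graph $B_i$ consists of the edges purchased among $e_1,\dots,e_i$. A $(t,b)$-strategy is an online algorithm (deterministic or randomised) that Builder follows in this model where she sees only the first $t$ edges of the permutation and purchases at most $b$ of them; it fails if $B_t$ does not have the target property. Here $\tau_1=\min\{m: \delta(\mathbf{G}_{n,m})\ge 1\}$ is the hitting time for having no isolated vertices. *)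

theory Defs
  imports "HOL-Probability.Probability" "HOL-Combinatorics.Multiset_Permutations" "HOL-Library.Ramsey"
begin

text \<open>Graphs live on a fixed vertex set and are identified with their edge sets; an edge is a
  two-element set of vertices.\<close>

type_synonym edge = "nat set"

definition complete_edges :: "nat \<Rightarrow> edge set" where
  "complete_edges n = nsets {1..n} 2"

definition vertex_degree :: "edge set \<Rightarrow> nat \<Rightarrow> nat" where
  "vertex_degree E v = card {e \<in> E. v \<in> e}"

text \<open>Only meaningful for finite nonempty \<open>V\<close>.\<close>

definition min_degree :: "nat set \<Rightarrow> edge set \<Rightarrow> nat" where
  "min_degree V E = Min (vertex_degree E ` V)"

text \<open>An outcome of the random graph process is a duplicate-free list of all edges of the
  complete graph, with \<open>e\<^sub>i\<close> at list position \<open>i - 1\<close>.\<close>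

definition edge_orders :: "nat \<Rightarrow> edge list set" where
  "edge_orders n = permutations_of_set (complete_edges n)"

definition graph_process :: "nat \<Rightarrow> edge list pmf" where
  "graph_process n = pmf_of_set (edge_orders n)"

definition process_graph :: "edge list \<Rightarrow> nat \<Rightarrow> edge set" where
  "process_graph es m = set (take m es)"

text \<open>For \<open>n \<ge> 2\<close> the complete graph has minimum degree at least 1, so on an edge order the
  minimum is attained; for \<open>n < 2\<close> the value is irrelevant.\<close>

definition tau1 :: "nat \<Rightarrow> edge list \<Rightarrow> nat" where
  "tau1 n es = (LEAST m. min_degree {1..n} (process_graph es m) \<ge> 1)"

text \<open>A deterministic online algorithm maps the list \<open>[e\<^sub>1, \<dots>, e\<^sub>i]\<close> of edges seen so far to the
  decision whether to purchase the last edge \<open>e\<^sub>i\<close>. Builder's own earlier decisions need not be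
  passed as an argument, since the algorithm together with the seen edges determines them.\<close>

type_synonym det_strategy = "edge list \<Rightarrow> bool"

definition builder_graph :: "det_strategy \<Rightarrow> edge list \<Rightarrow> nat \<Rightarrow> edge set" where
  "builder_graph \<sigma> es i = {es ! j | j. j < i \<and> j < length es \<and> \<sigma> (take (Suc j) es)}"

text \<open>A randomised online algorithm is a probability distribution over deterministic ones, drawn
  independently of the edge order; deterministic algorithms are the point masses \<open>return_pmf \<sigma>\<close>.
  Discrete distributions suffice: for fixed \<open>n\<close> there are only finitely many possible histories, so
  only finitely many deterministic algorithms can be told apart.

  The number \<open>t\<close> of edges seen may depend on the edge order, and the budget \<open>b\<close> is respected for
  every edge order and every realisation of Builder's randomness. What \<open>\<sigma>\<close> does after step \<open>t\<close>
  plays no role, as only \<open>B\<^sub>t\<close> is ever considered.\<close>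

definition tb_strategy :: "nat \<Rightarrow> (edge list \<Rightarrow> nat) \<Rightarrow> real \<Rightarrow> det_strategy pmf \<Rightarrow> bool" where
  "tb_strategy n t b S \<longleftrightarrow>
     (\<forall>\<sigma> \<in> set_pmf S. \<forall>es \<in> edge_orders n. real (card (builder_graph \<sigma> es (t es))) \<le> b)"

definition failure_prob ::
  "nat \<Rightarrow> (edge list \<Rightarrow> nat) \<Rightarrow> (edge set \<Rightarrow> bool) \<Rightarrow> det_strategy pmf \<Rightarrow> real" where
  "failure_prob n t P S =
     measure_pmf.prob (pair_pmf (graph_process n) S) {(es, \<sigma>). \<not> P (builder_graph \<sigma> es (t es))}"

end

theory Submission
  imports Defs "HOL-Real_Asymp.Real_Asymp"
begin

text \<open>Call an edge a first edge of \<open>v\<close> if it is the earliest edge at \<open>v\<close>. An edge leads all edges that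
  meet it with probability \<open>1/(2n - 3)\<close>, so about \<open>n/4\<close> edges are first edges of both their endpoints,
  and \<open>n - n/4 = 3n/4\<close> edges are first edges at all. All of them arrive by time \<open>\<tau>\<^sub>1\<close>, hence Builder
  skips the first edge of at least about \<open>\<epsilon> n\<close> vertices in expectation, and of at least about \<open>\<epsilon> n/2\<close>
  before a time \<open>m\<^sub>0\<close> (linear in \<open>n\<close>) at which a fraction of about \<open>\<epsilon>/2\<close> of the vertices is
  isolated. Whatever Builder knows, a vertex just skipped stays a leaf until \<open>m\<^sub>0\<close> with at least the
  probability of being isolated at \<open>m\<^sub>0\<close>; this leaves a set \<open>W\<close> of skipped leaves at time \<open>m\<^sub>0\<close>, of
  expected size of order \<open>\<epsilon>\<^sup>2 n\<close>. Choose \<open>m\<^sub>1\<close> such that a leaf sees no edge between \<open>m\<^sub>0\<close> and \<open>m\<^sub>1\<close>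
  with probability \<open>p\<close> about \<open>1/(2n)\<close>. By inclusion-exclusion, with probability at least
  \<open>|W| p (1 - n p)\<close> some vertex of \<open>W\<close> is untouched in that period while no isolated vertex remains;
  then \<open>\<tau>\<^sub>1 \<le> m\<^sub>1\<close> and Builder has failed.\<close>

section \<open>Uniform orders with a prescribed prefix\<close>

text \<open>The sample space after the elements of \<open>xs\<close> have been revealed. It is empty
  unless \<open>xs\<close> is duplicate-free with elements in \<open>A\<close>, hence these two
  hypotheses in the lemmas below.\<close>

definition completions :: "'a set \<Rightarrow> 'a list \<Rightarrow> 'a list set" where
  "completions A xs = {es. distinct es \<and> set es = A \<and> take (length xs) es = xs}"

text \<open>Conditional expectation of \<open>f\<close> given that a uniform order starts with
  \<open>xs\<close>. As a finite average it is accessible to induction on prefixes.\<close>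

definition cond_avg :: "'a set \<Rightarrow> 'a list \<Rightarrow> ('a list \<Rightarrow> real) \<Rightarrow> real" where
  "cond_avg A xs f = (\<Sum>es\<in>completions A xs. f es) / real (card (completions A xs))"

lemma completionsD:
  assumes "es \<in> completions A xs"
  shows "distinct es" "set es = A" "take (length xs) es = xs" "length es = card A"
  using assms distinct_card[of es] by (auto simp: completions_def)

lemma completions_nth:
  assumes "es \<in> completions A xs" "i < length xs"
  shows "es ! i = xs ! i"
  using completionsD(3)[OF assms(1)] assms(2) by (metis nth_take)

lemma completions_Nil: "completions A [] = permutations_of_set A"
  unfolding completions_def permutations_of_set_def by simp blast

lemma finite_completions [simp]:
  assumes "finite A"
  shows "finite (completions A xs)"
proof -
  have "completions A xs \<subseteq> permutations_of_set A"
    unfolding completions_def permutations_of_set_def by blast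
  then show ?thesis
    by (rule finite_subset) (simp add: assms)
qed

lemma completions_full:
  assumes "distinct xs" "set xs = A"
  shows "completions A xs = {xs}"
proof -
  have "es = xs" if "es \<in> completions A xs" for es
  proof -
    have "length es = length xs"
      using completionsD(4)[OF that] assms distinct_card[of xs] by simp
    then show ?thesis
      using completionsD(3)[OF that] by simp
  qed
  moreover have "xs \<in> completions A xs"
    using assms by (auto simp: completions_def)
  ultimately show ?thesis by blast
qed

lemma completions_snoc:
  assumes "finite A" "distinct xs" "set xs \<subseteq> A" "A - set xs \<noteq> {}"
  shows "completions A xs = (\<Union>e\<in>A - set xs. completions A (xs @ [e]))"
proof (intro subset_antisym subsetI)
  fix es assume es: "es \<in> completions A xs"
  note D = completionsD[OF es]
  have len: "length xs < length es"
    using D(4) assms distinct_card[of xs] psubset_card_mono[of A "set xs"] by auto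
  define e where "e = es ! length xs"
  have t: "take (Suc (length xs)) es = xs @ [e]"
    using len D(3) by (simp add: take_Suc_conv_app_nth e_def)
  have "distinct (xs @ [e])"
    using D(1) t by (metis distinct_take)
  moreover have "e \<in> A"
    using D(2) len by (auto simp: e_def)
  ultimately have "e \<in> A - set xs" by auto
  moreover have "es \<in> completions A (xs @ [e])"
    using t D by (auto simp: completions_def)
  ultimately show "es \<in> (\<Union>e\<in>A - set xs. completions A (xs @ [e]))" by blast
next
  fix es assume "es \<in> (\<Union>e\<in>A - set xs. completions A (xs @ [e]))"
  then obtain e where e: "es \<in> completions A (xs @ [e])" by blast
  have "take (length xs) (take (Suc (length xs)) es) = xs"
    using completionsD(3)[OF e] by (metis append_eq_conv_conj length_append_singleton)
  then have "take (length xs) es = xs" by (simp add: min_def)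
  then show "es \<in> completions A xs"
    using completionsD[OF e] by (auto simp: completions_def)
qed

lemma disjoint_completions_snoc:
  "e \<noteq> e' \<Longrightarrow> completions A (xs @ [e]) \<inter> completions A (xs @ [e']) = {}"
  by (auto simp: completions_def)

lemma sum_completions_snoc:
  fixes f :: "'a list \<Rightarrow> 'b :: comm_monoid_add"
  assumes "finite A" "distinct xs" "set xs \<subseteq> A" "A - set xs \<noteq> {}"
  shows "(\<Sum>es\<in>completions A xs. f es) =
    (\<Sum>e\<in>A - set xs. \<Sum>es\<in>completions A (xs @ [e]). f es)"
  unfolding completions_snoc[OF assms]
proof (rule sum.UNION_disjoint)
  show "\<forall>e\<in>A - set xs. \<forall>e'\<in>A - set xs. e \<noteq> e' \<longrightarrow>
      completions A (xs @ [e]) \<inter> completions A (xs @ [e']) = {}"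
    using disjoint_completions_snoc[of _ _ A xs] by blast
qed (use assms(1) in auto)

text \<open>Backward induction on the history: complete orders are the base, and a prefix inherits
  the claim from all its one-step extensions. The number of unrevealed elements decreases.\<close>

lemma prefix_induct [consumes 3, case_names full snoc]:
  assumes "finite A" "distinct xs" "set xs \<subseteq> A"
    and full: "\<And>xs. distinct xs \<Longrightarrow> set xs = A \<Longrightarrow> P xs"
    and snoc: "\<And>xs. distinct xs \<Longrightarrow> set xs \<subseteq> A \<Longrightarrow> A - set xs \<noteq> {} \<Longrightarrow>
      (\<And>e. e \<in> A - set xs \<Longrightarrow> P (xs @ [e])) \<Longrightarrow> P xs"
  shows "P xs"
  using assms(2,3)
proof (induction "card (A - set xs)" arbitrary: xs rule: less_induct)
  case less
  show ?case
  proof (cases "A - set xs = {}")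
    case True
    then show ?thesis using full less.prems by blast
  next
    case False
    show ?thesis
    proof (rule snoc[OF less.prems False])
      fix e assume e: "e \<in> A - set xs"
      then have "A - set (xs @ [e]) \<subset> A - set xs" by auto
      then have "card (A - set (xs @ [e])) < card (A - set xs)"
        using assms(1) by (intro psubset_card_mono) auto
      then show "P (xs @ [e])"
        using e less.prems by (intro less.hyps) auto
    qed
  qed
qed

section \<open>Counting completions and averaging over the next element\<close>

lemma card_Diff_prefix:
  assumes "distinct xs" "set xs \<subseteq> A"
  shows "card (A - set xs) = card A - length xs"
  using assms by (simp add: card_Diff_subset distinct_card)

lemma length_prefix_less:
  assumes "finite A" "distinct xs" "set xs \<subseteq> A" "A - set xs \<noteq> {}"
  shows "length xs < card A"
  using assms distinct_card[of xs] psubset_card_mono[of A "set xs"] by auto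

lemma length_prefix_le:
  assumes "finite A" "distinct xs" "set xs \<subseteq> A"
  shows "length xs \<le> card A"
  using assms distinct_card[of xs] card_mono[of A "set xs"] by auto

lemma card_completions:
  assumes "finite A" "distinct xs" "set xs \<subseteq> A"
  shows "card (completions A xs) = fact (card A - length xs)"
  using assms
proof (induction xs rule: prefix_induct)
  case (full xs)
  then show ?case using completions_full[of xs A] distinct_card[of xs] by auto
next
  case (snoc xs)
  have "card (completions A xs) = (\<Sum>e\<in>A - set xs. card (completions A (xs @ [e])))"
    using sum_completions_snoc[OF assms(1) snoc(1-3), of "\<lambda>_. 1::nat"] by simp
  also have "\<dots> = (\<Sum>e\<in>A - set xs. fact (card A - Suc (length xs)))"
    using snoc by simp
  also have "\<dots> = (card A - length xs) * fact (card A - Suc (length xs))"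
    using card_Diff_prefix snoc by simp
  also have "\<dots> = fact (card A - length xs)"
    using length_prefix_less[OF assms(1) snoc(1-3)]
    by (metis Suc_diff_Suc fact_Suc of_nat_id)
  finally show ?case .
qed

text \<open>All one-step extensions of \<open>xs\<close> have equally many completions, so
  conditioning on the next element is an unweighted mean. This recursion drives the prefix
  inductions below.\<close>

lemma cond_avg_snoc:
  assumes "finite A" "distinct xs" "set xs \<subseteq> A" "A - set xs \<noteq> {}"
  shows "cond_avg A xs f =
    (\<Sum>e\<in>A - set xs. cond_avg A (xs @ [e]) f) / (real (card A) - real (length xs))"
proof -
  have len: "length xs < card A" using length_prefix_less assms by blast
  have "(\<Sum>e\<in>A - set xs. cond_avg A (xs @ [e]) f) =
      (\<Sum>e\<in>A - set xs. (\<Sum>es\<in>completions A (xs @ [e]). f es) / fact (card A - Suc (length xs)))"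
    using assms by (intro sum.cong) (auto simp: cond_avg_def card_completions)
  also have "\<dots> = (\<Sum>es\<in>completions A xs. f es) / fact (card A - Suc (length xs))"
    using sum_completions_snoc[OF assms, of f] by (simp add: sum_divide_distrib)
  finally have "(\<Sum>e\<in>A - set xs. cond_avg A (xs @ [e]) f) / (real (card A) - real (length xs)) =
      (\<Sum>es\<in>completions A xs. f es) / (real (card A - length xs) * fact (card A - Suc (length xs)))"
    using len by (simp add: of_nat_diff mult.commute)
  also have "real (card A - length xs) * fact (card A - Suc (length xs)) =
      fact (card A - length xs)"
    using len by (metis Suc_diff_Suc fact_Suc)
  finally show ?thesis
    using assms by (simp add: cond_avg_def card_completions)
qed

section \<open>Monotonicity, linearity and tower property of conditional averages\<close>

lemma cond_avg_mono:
  assumes "\<And>es. es \<in> completions A xs \<Longrightarrow> f es \<le> g es"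
  shows "cond_avg A xs f \<le> cond_avg A xs g"
  unfolding cond_avg_def using assms by (intro divide_right_mono sum_mono) auto

lemma cond_avg_nonneg:
  assumes "\<And>es. es \<in> completions A xs \<Longrightarrow> f es \<ge> 0"
  shows "cond_avg A xs f \<ge> 0"
  unfolding cond_avg_def using assms by (intro divide_nonneg_nonneg sum_nonneg) auto

lemma cond_avg_cong:
  assumes "\<And>es. es \<in> completions A xs \<Longrightarrow> f es = g es"
  shows "cond_avg A xs f = cond_avg A xs g"
  using assms by (intro antisym cond_avg_mono) auto

lemma cond_avg_const:
  assumes "finite A" "distinct xs" "set xs \<subseteq> A"
  shows "cond_avg A xs (\<lambda>_. c) = c"
  using card_completions[OF assms] by (simp add: cond_avg_def)

lemma cond_avg_diff: "cond_avg A xs (\<lambda>es. f es - g es) = cond_avg A xs f - cond_avg A xs g"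
  by (simp add: cond_avg_def sum_subtractf diff_divide_distrib)

lemma cond_avg_sum: "cond_avg A xs (\<lambda>es. \<Sum>i\<in>I. f i es) = (\<Sum>i\<in>I. cond_avg A xs (f i))"
  unfolding cond_avg_def by (subst sum.swap) (simp add: sum_divide_distrib)

lemma cond_avg_cmult: "cond_avg A xs (\<lambda>es. c * f es) = c * cond_avg A xs f"
  by (simp add: cond_avg_def sum_distrib_left[symmetric])

text \<open>At prefixes shorter than \<open>m\<close> both sides satisfy the recursion over the next
  element; at length \<open>m\<close> the inner average is the constant
  \<open>cond_avg A xs f\<close>.\<close>

lemma cond_avg_tower:
  assumes "finite A" "distinct xs" "set xs \<subseteq> A" "length xs \<le> m" "m \<le> card A"
  shows "cond_avg A xs (\<lambda>es. cond_avg A (take m es) f) = cond_avg A xs f"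
  using assms
proof (induction xs rule: prefix_induct)
  case (full xs)
  then have "length xs = card A" using distinct_card[of xs] by simp
  then have "m = length xs" using full by simp
  then show ?case using full by (simp add: cond_avg_def completions_full)
next
  case (snoc xs)
  show ?case
  proof (cases "length xs = m")
    case True
    have "cond_avg A xs (\<lambda>es. cond_avg A (take m es) f) = cond_avg A xs (\<lambda>_. cond_avg A xs f)"
      by (rule cond_avg_cong) (simp add: completionsD(3) flip: True)
    then show ?thesis using assms(1) snoc by (simp add: cond_avg_const)
  next
    case False
    then show ?thesis using assms(1) snoc by (simp add: cond_avg_snoc)
  qed
qed

text \<open>As long as \<open>D\<close> is avoided it stays wholly unrevealed, so step
  \<open>i\<close> avoids it with probability \<open>1 - card D / (card A - i)\<close>; these
  factors multiply along the recursion.\<close>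

lemma cond_avg_avoid:
  assumes "finite A" "distinct xs" "set xs \<subseteq> A"
    and "D \<subseteq> A - set xs" "length xs \<le> m" "m \<le> card A"
  shows "cond_avg A xs (\<lambda>es. of_bool (\<forall>i\<in>{length xs..<m}. es ! i \<notin> D)) =
    (\<Prod>i\<in>{length xs..<m}. 1 - real (card D) / (real (card A) - real i))"
  using assms
proof (induction xs rule: prefix_induct)
  case (full xs)
  then have "length xs = card A" using distinct_card[of xs] by simp
  then have "m = length xs" using full by simp
  then show ?case using full assms(1) by (simp add: cond_avg_const)
next
  case (snoc xs)
  note len = length_prefix_less[OF assms(1) snoc(1-3)]
  show ?case
  proof (cases "length xs = m")
    case True
    then show ?thesis using snoc assms(1) by (simp add: cond_avg_const)
  next
    case False
    then have m: "length xs < m" using snoc by simp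
    let ?f = "\<lambda>es. of_bool (\<forall>i\<in>{length xs..<m}. es ! i \<notin> D) :: real"
    let ?\<pi> = "\<Prod>i\<in>{Suc (length xs)..<m}. 1 - real (card D) / (real (card A) - real i)"
    have nth: "es ! length xs = e" if "es \<in> completions A (xs @ [e])" for es e
      using completions_nth[OF that, of "length xs"] by simp
    have split: "{length xs..<m} = insert (length xs) {Suc (length xs)..<m}"
      using m by auto
    have "cond_avg A (xs @ [e]) ?f = (if e \<in> D then 0 else ?\<pi>)" if e: "e \<in> A - set xs" for e
    proof (cases "e \<in> D")
      case True
      have "cond_avg A (xs @ [e]) ?f = cond_avg A (xs @ [e]) (\<lambda>_. 0)"
        using nth True m by (intro cond_avg_cong) (auto simp: split)
      then show ?thesis using True by (simp add: cond_avg_def)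
    next
      case False
      have "cond_avg A (xs @ [e]) ?f =
          cond_avg A (xs @ [e]) (\<lambda>es. of_bool (\<forall>i\<in>{length (xs @ [e])..<m}. es ! i \<notin> D))"
        using nth False by (intro cond_avg_cong) (auto simp: split)
      also have "\<dots> = ?\<pi>"
        using snoc.IH[OF e] snoc.prems m False by auto
      finally show ?thesis using False by simp
    qed
    then have "cond_avg A xs ?f =
        (\<Sum>e\<in>A - set xs. if e \<in> D then 0 else ?\<pi>) / (real (card A) - real (length xs))"
      using cond_avg_snoc[OF assms(1) snoc(1-3), of ?f] by simp
    also have "(\<Sum>e\<in>A - set xs. if e \<in> D then 0 else ?\<pi>) = (\<Sum>e\<in>A - set xs - D. ?\<pi>)"
      using assms(1) by (intro sum.mono_neutral_cong_right) auto
    also have "\<dots> = (real (card A) - real (length xs) - real (card D)) * ?\<pi>"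
    proof -
      have fin: "finite (A - set xs)" using assms(1) by simp
      have "card (A - set xs - D) = card A - length xs - card D"
        using snoc fin by (simp add: card_Diff_subset finite_subset distinct_card)
      moreover have "card D \<le> card A - length xs"
        using snoc fin card_mono[OF fin, of D] by (simp add: card_Diff_prefix)
      ultimately show ?thesis using len by (simp add: of_nat_diff)
    qed
    finally have "cond_avg A xs ?f =
        (1 - real (card D) / (real (card A) - real (length xs))) * ?\<pi>"
      using len by (simp add: field_simps)
    then show ?thesis by (subst (2) split) simp
  qed
qed

text \<open>By symmetry every element of \<open>D\<close> is equally likely to be the earliest. In
  the induction the next element is \<open>d\<close>, or another element of \<open>D\<close>, which
  rules the event out, or lies outside \<open>D\<close>, where the value is
  \<open>1 / card D\<close> again.\<close>

lemma cond_avg_first: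
  assumes "finite A" "distinct xs" "set xs \<subseteq> A"
    and "D \<subseteq> A - set xs" "d \<in> D"
  shows "cond_avg A xs (\<lambda>es. of_bool (\<exists>j<length es. es ! j = d \<and> (\<forall>i<j. es ! i \<notin> D))) =
    1 / real (card D)"
  using assms
proof (induction xs rule: prefix_induct)
  case (full xs)
  then show ?case by simp
next
  case (snoc xs)
  note len = length_prefix_less[OF assms(1) snoc(1-3)]
  let ?f = "\<lambda>es. of_bool (\<exists>j<length es. es ! j = d \<and> (\<forall>i<j. es ! i \<notin> D)) :: real"
  have finD: "finite D" using snoc.prems(1) assms(1) by (meson finite_Diff finite_subset)
  then have D0: "card D > 0" using snoc.prems(2) by (auto simp: card_gt_0_iff)
  have nth: "es ! length xs = e" if "es \<in> completions A (xs @ [e])" for es e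
    using completions_nth[OF that, of "length xs"] by simp
  have nth': "es ! i \<in> set xs" if "es \<in> completions A (xs @ [e])" "i < length xs" for es e i
    using completions_nth[OF that(1), of i] that(2) by (simp add: nth_append)
  have "cond_avg A (xs @ [e]) ?f = of_bool (e = d) + of_bool (e \<notin> D) / real (card D)"
    if e: "e \<in> A - set xs" for e
  proof (cases "e \<in> D")
    case True
    have "?f es = of_bool (e = d)" if es: "es \<in> completions A (xs @ [e])" for es
    proof -
      have "(\<exists>j<length es. es ! j = d \<and> (\<forall>i<j. es ! i \<notin> D)) \<longleftrightarrow> e = d"
      proof
        assume "\<exists>j<length es. es ! j = d \<and> (\<forall>i<j. es ! i \<notin> D)"
        then obtain j where j: "j < length es" "es ! j = d" "\<forall>i<j. es ! i \<notin> D" by blast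
        have "\<not> length xs < j" using j True nth[OF es] by auto
        moreover have "\<not> j < length xs" using j nth'[OF es] snoc.prems by auto
        ultimately show "e = d" using j nth[OF es] by (metis linorder_neqE_nat)
      next
        assume "e = d"
        moreover have "es ! i \<notin> D" if "i < length xs" for i
          using nth'[OF es that] snoc.prems by auto
        ultimately show "\<exists>j<length es. es ! j = d \<and> (\<forall>i<j. es ! i \<notin> D)"
          using nth[OF es] len completionsD(4)[OF es] by (intro exI[of _ "length xs"]) auto
      qed
      then show ?thesis by simp
    qed
    then have "cond_avg A (xs @ [e]) ?f = cond_avg A (xs @ [e]) (\<lambda>_. of_bool (e = d))"
      by (intro cond_avg_cong) auto
    also have "\<dots> = of_bool (e = d)"
      using e snoc assms(1) by (intro cond_avg_const) auto
    finally show ?thesis using True by simp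
  next
    case False
    then have "cond_avg A (xs @ [e]) ?f = 1 / real (card D)"
      using snoc e by (intro snoc.IH) auto
    then show ?thesis using False snoc.prems by auto
  qed
  then have "(\<Sum>e\<in>A - set xs. cond_avg A (xs @ [e]) ?f) =
      (\<Sum>e\<in>A - set xs. of_bool (e = d)) + (\<Sum>e\<in>A - set xs. of_bool (e \<notin> D)) / real (card D)"
    by (simp add: sum.distrib sum_divide_distrib)
  also have "(\<Sum>e\<in>A - set xs. of_bool (e = d)) = (1::real)"
  proof -
    have "(A - set xs) \<inter> {e. e = d} = {d}" using snoc by auto
    then show ?thesis using assms(1) by (simp add: sum_of_bool_eq)
  qed
  also have "(\<Sum>e\<in>A - set xs. of_bool (e \<notin> D)) = real (card A) - real (length xs) - real (card D)"
  proof -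
    have fin: "finite (A - set xs)" using assms(1) by simp
    have "(A - set xs) \<inter> {e. e \<notin> D} = A - set xs - D" by auto
    moreover have "card (A - set xs - D) = card A - length xs - card D"
      using snoc finD by (simp add: card_Diff_subset distinct_card)
    moreover have "card D \<le> card A - length xs"
      using snoc card_mono[OF fin, of D] by (simp add: card_Diff_prefix)
    ultimately show ?thesis using len fin by (simp add: sum_of_bool_eq of_nat_diff)
  qed
  finally have "cond_avg A xs ?f = (1 + (real (card A) - real (length xs) - real (card D)) / real (card D))
      / (real (card A) - real (length xs))"
    using cond_avg_snoc[OF assms(1) snoc(1-3), of ?f] by simp
  also have "\<dots> = 1 / real (card D)"
    using D0 len by (simp add: field_simps)
  finally show ?case .
qed

section \<open>Skipped first edges\<close>

lemma complete_edgesD: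
  assumes "e \<in> complete_edges n"
  shows "e \<subseteq> {1..n}" "card e = 2" "finite e"
  using assms by (auto simp: complete_edges_def nsets_def)

lemma finite_complete_edges [simp]: "finite (complete_edges n)"
  by (simp add: complete_edges_def finite_imp_finite_nsets)

lemma edge_ordersD:
  assumes "es \<in> edge_orders n"
  shows "distinct es" "set es = complete_edges n"
  using assms by (auto simp: edge_orders_def permutations_of_set_def)

lemma min_degree_ge_1_iff:
  assumes "finite V" "V \<noteq> {}" "finite E"
  shows "min_degree V E \<ge> 1 \<longleftrightarrow> V \<subseteq> \<Union>E"
proof -
  have "min_degree V E \<ge> 1 \<longleftrightarrow> (\<forall>v\<in>V. vertex_degree E v \<ge> 1)"
    using assms by (simp add: min_degree_def)
  also have "\<dots> \<longleftrightarrow> (\<forall>v\<in>V. {e \<in> E. v \<in> e} \<noteq> {})"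
    using assms(3) by (simp add: vertex_degree_def Suc_le_eq card_gt_0_iff)
  also have "\<dots> \<longleftrightarrow> V \<subseteq> \<Union>E" by blast
  finally show ?thesis .
qed

text \<open>The least number in \<open>tau1\<close> has its property only if some time does; for
  \<open>n \<ge> 2\<close> the complete graph covers all vertices.\<close>

lemma process_graph_tau1_covers:
  assumes "n \<ge> 2" "es \<in> edge_orders n"
  shows "{1..n} \<subseteq> \<Union>(set (take (tau1 n es) es))"
proof -
  have "v \<in> \<Union>(complete_edges n)" if "v \<in> {1..n}" for v
  proof -
    define u where "u = (if v = 1 then 2 else 1 :: nat)"
    have "{u, v} \<in> complete_edges n"
      using that assms(1) by (auto simp: complete_edges_def u_def)
    then show ?thesis by blast
  qed
  then have "min_degree {1..n} (process_graph es (length es)) \<ge> 1"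
    using assms edge_ordersD[OF assms(2)]
    by (subst min_degree_ge_1_iff) (auto simp: process_graph_def)
  then have "min_degree {1..n} (process_graph es (tau1 n es)) \<ge> 1"
    unfolding tau1_def by (rule LeastI)
  then show ?thesis
    using assms(1) by (subst (asm) min_degree_ge_1_iff) (auto simp: process_graph_def)
qed

lemma tau1_le:
  assumes "n \<ge> 2" "{1..n} \<subseteq> \<Union>(set (take m es))"
  shows "tau1 n es \<le> m"
proof -
  have "min_degree {1..n} (process_graph es m) \<ge> 1"
    using assms by (subst min_degree_ge_1_iff) (auto simp: process_graph_def)
  then show ?thesis
    unfolding tau1_def by (rule Least_le)
qed

text \<open>Settled the moment the first edge at \<open>v\<close> arrives, whatever follows.
  Position \<open>j\<close> carries edge number \<open>j + 1\<close>, so the decision on it reads a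
  history of length \<open>Suc j\<close>.\<close>

definition skipped :: "det_strategy \<Rightarrow> nat \<Rightarrow> edge list \<Rightarrow> nat \<Rightarrow> bool" where
  "skipped \<sigma> m es v \<longleftrightarrow>
     (\<exists>j<m. v \<in> es ! j \<and> (\<forall>i<j. v \<notin> es ! i) \<and> \<not> \<sigma> (take (Suc j) es))"

text \<open>The strengthening that keeps \<open>v\<close> isolated in Builder's graph up to time
  \<open>m\<close>.\<close>

definition skipped_leaf :: "det_strategy \<Rightarrow> nat \<Rightarrow> edge list \<Rightarrow> nat \<Rightarrow> bool" where
  "skipped_leaf \<sigma> m es v \<longleftrightarrow>
     (\<exists>j<m. v \<in> es ! j \<and> (\<forall>i<m. i \<noteq> j \<longrightarrow> v \<notin> es ! i) \<and> \<not> \<sigma> (take (Suc j) es))"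

text \<open>With \<open>D\<close> the set of edges meeting \<open>e\<close>, this says that
  \<open>e\<close> is the first edge of both its endpoints.\<close>

definition leads :: "edge list \<Rightarrow> edge \<Rightarrow> edge set \<Rightarrow> bool" where
  "leads es e D \<longleftrightarrow> (\<exists>j<length es. es ! j = e \<and> (\<forall>i<j. es ! i \<notin> D))"

text \<open>Vertices neither skipped nor untouched at time \<open>m\<close> have a purchased first
  edge. Charging each such vertex to its first edge is injective, except that one edge may serve
  both endpoints; these edges are counted by \<open>leads\<close>.\<close>

lemma card_skipped_ge:
  assumes n: "n \<ge> 2" and es: "es \<in> edge_orders n" and m: "m \<le> length es"
  shows "n \<le> card {v \<in> {1..n}. skipped \<sigma> m es v} + card {v \<in> {1..n}. \<forall>i<m. v \<notin> es ! i}
    + card {e \<in> complete_edges n. leads es e {f \<in> complete_edges n. f \<inter> e \<noteq> {}}}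
    + card (builder_graph \<sigma> es (tau1 n es))"
proof -
  let ?V = "{1..n}" and ?B = "builder_graph \<sigma> es (tau1 n es)"
  let ?S = "{v \<in> ?V. skipped \<sigma> m es v}" and ?I = "{v \<in> ?V. \<forall>i<m. v \<notin> es ! i}"
  let ?D = "{e \<in> complete_edges n. leads es e {f \<in> complete_edges n. f \<inter> e \<noteq> {}}}"
  define T where "T = ?V - ?I - ?S"
  define fi where "fi v = (LEAST j. v \<in> es ! j)" for v
  \<comment> \<open>\<open>T1\<close> keeps the smallest vertex for each first edge, so it injects
    into Builder's edges; each vertex of \<open>T - T1\<close> is the larger endpoint of a shared
    first edge.\<close>
  define T1 where "T1 = {v \<in> T. \<forall>u\<in>T. u < v \<longrightarrow> fi u \<noteq> fi v}"
  note eo = edge_ordersD[OF es]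
  have fi: "v \<in> es ! fi v" "\<forall>i<fi v. v \<notin> es ! i" "fi v < m" "\<sigma> (take (Suc (fi v)) es)"
    if "v \<in> T" for v
  proof -
    obtain j where j: "j < m" "v \<in> es ! j"
      using \<open>v \<in> T\<close> by (auto simp: T_def)
    show 1: "v \<in> es ! fi v"
      unfolding fi_def using j(2) by (rule LeastI)
    show 2: "\<forall>i<fi v. v \<notin> es ! i"
      unfolding fi_def using not_less_Least by blast
    have "fi v \<le> j"
      unfolding fi_def using j(2) by (rule Least_le)
    then show 3: "fi v < m" using j by simp
    show "\<sigma> (take (Suc (fi v)) es)"
      using 1 2 3 \<open>v \<in> T\<close> by (auto simp: T_def skipped_def)
  qed
  have fi_eq: "fi u = fi v" if "es ! fi u = es ! fi v" "u \<in> T" "v \<in> T" for u v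
    using that fi(3)[of u] fi(3)[of v] m eo(1) by (simp add: nth_eq_iff_index_eq)
  \<comment> \<open>At time \<open>tau1\<close> no vertex is isolated, so every first edge has been
    offered; this allows the purchases to be counted at \<open>tau1\<close> instead of
    \<open>m\<close>.\<close>
  have fi_tau: "fi v < tau1 n es" if v: "v \<in> T" for v
  proof -
    have "v \<in> \<Union>(set (take (tau1 n es) es))"
      using process_graph_tau1_covers[OF n es] v by (auto simp: T_def)
    then obtain i where "i < tau1 n es" "v \<in> es ! i"
      by (auto simp: in_set_conv_nth)
    then show ?thesis
      using fi(2)[OF v] by (meson le_less_trans not_le)
  qed
  have finB: "finite ?B"
    by (rule finite_subset[of _ "(!) es ` {..<length es}"]) (auto simp: builder_graph_def)
  have "card T1 \<le> card ?B"
  proof (rule card_inj_on_le[OF _ _ finB])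
    show "inj_on (\<lambda>v. es ! fi v) T1"
      by (rule linorder_inj_onI) (use fi_eq in \<open>auto simp: T1_def\<close>)
    show "(\<lambda>v. es ! fi v) ` T1 \<subseteq> ?B"
    proof clarify
      fix v assume "v \<in> T1"
      then have v: "v \<in> T" by (simp add: T1_def)
      show "es ! fi v \<in> ?B"
        unfolding builder_graph_def using fi[OF v] fi_tau[OF v] m by auto
    qed
  qed
  moreover have "card (T - T1) \<le> card ?D"
  proof (rule card_inj_on_le)
    have pair: "\<exists>u. u < v \<and> u \<in> T \<and> fi u = fi v \<and> es ! fi v = {u, v}" if v: "v \<in> T - T1" for v
    proof -
      obtain u where u: "u \<in> T" "u < v" "fi u = fi v"
        using v by (auto simp: T1_def)
      have "es ! fi v \<in> complete_edges n"
        using fi(3)[of v] v m eo(2) nth_mem[of "fi v" es] by auto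
      moreover have "{u, v} \<subseteq> es ! fi v"
        using fi(1)[of u] fi(1)[of v] u v by auto
      ultimately have "{u, v} = es ! fi v"
        using u(2) complete_edgesD[of "es ! fi v" n] by (intro card_subset_eq) auto
      then show ?thesis using u by auto
    qed
    \<comment> \<open>The vertex is recovered from its first edge as the larger endpoint.\<close>
    show "inj_on (\<lambda>v. es ! fi v) (T - T1)"
    proof (rule inj_onI)
      fix v w assume "v \<in> T - T1" "w \<in> T - T1" and eq: "es ! fi v = es ! fi w"
      then obtain u u' where "u < v" "es ! fi v = {u, v}" "u' < w" "es ! fi w = {u', w}"
        using pair by meson
      then show "v = w" using eq by (auto simp: doubleton_eq_iff)
    qed
    show "(\<lambda>v. es ! fi v) ` (T - T1) \<subseteq> ?D"
    proof clarify
      fix v assume v: "v \<in> T" "v \<notin> T1"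
      then obtain u where u: "u \<in> T" "fi u = fi v" "es ! fi v = {u, v}"
        using pair by blast
      have "es ! fi v \<in> complete_edges n"
        using fi(3)[of v] v m eo(2) nth_mem[of "fi v" es] by auto
      moreover have "leads es (es ! fi v) {f \<in> complete_edges n. f \<inter> es ! fi v \<noteq> {}}"
        unfolding leads_def
      proof (intro exI conjI allI impI)
        show "fi v < length es" using fi(3)[OF v(1)] m by simp
        fix i assume "i < fi v"
        then have "u \<notin> es ! i" "v \<notin> es ! i"
          using fi(2)[OF u(1)] fi(2)[OF v(1)] u(2) by simp_all
        then show "es ! i \<notin> {f \<in> complete_edges n. f \<inter> es ! fi v \<noteq> {}}"
          unfolding u(3) by blast
      qed simp
      ultimately show "es ! fi v \<in> complete_edges n \<and>
          leads es (es ! fi v) {f \<in> complete_edges n. f \<inter> es ! fi v \<noteq> {}}" by simp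
    qed
  qed simp
  moreover have "card T = card T1 + card (T - T1)"
  proof -
    have "finite T" "T1 \<subseteq> T" by (auto simp: T_def T1_def)
    then show ?thesis by (simp add: card_Diff_subset card_mono finite_subset)
  qed
  moreover have "n \<le> card ?S + card ?I + card T"
  proof -
    have "?V = (?S \<union> ?I) \<union> T" unfolding T_def by blast
    then have "card ?V = card ((?S \<union> ?I) \<union> T)" by (rule arg_cong)
    moreover have "card ?V = n" by simp
    ultimately show ?thesis
      using card_Un_le[of "?S \<union> ?I" T] card_Un_le[of ?S ?I] by linarith
  qed
  ultimately show ?thesis by linarith
qed

text \<open>\<open>q m\<close> is the probability that \<open>v\<close> is isolated at time
  \<open>m\<close>. Backward induction makes the bound valid however decisions depend on the past:
  once the first edge at \<open>v\<close> is declined, \<open>d - 1\<close> edges must be avoided in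
  the remaining steps, which is at least as likely as avoiding \<open>d\<close> edges in all
  \<open>m\<close> steps.\<close>

lemma prob_skipped_leaf_ge:
  fixes A :: "edge set" and v :: nat
  defines "d \<equiv> card {e \<in> A. v \<in> e}"
  defines "q \<equiv> \<lambda>m. \<Prod>i<m. 1 - real d / (real (card A) - real i)"
  assumes fin: "finite A" and xs: "distinct xs" "set xs \<subseteq> A"
    and "\<forall>e\<in>set xs. v \<notin> e" "length xs \<le> m" and m: "m + d \<le> card A"
  shows "q m * cond_avg A xs (\<lambda>es. of_bool (skipped \<sigma> m es v)) \<le>
    cond_avg A xs (\<lambda>es. of_bool (skipped_leaf \<sigma> m es v))"
proof -
  have factor: "0 \<le> 1 - real d / (real (card A) - real i)"
      "1 - real d / (real (card A) - real i) \<le> 1" if "i < m" for i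
    using that m by (auto simp: divide_le_eq)
  \<comment> \<open>With \<open>m\<close> edges revealed and none at \<open>v\<close>, skipping has
    become impossible and the left side is zero.\<close>
  have base: "q m * cond_avg A xs (\<lambda>es. of_bool (skipped \<sigma> m es v)) \<le>
      cond_avg A xs (\<lambda>es. of_bool (skipped_leaf \<sigma> m es v))"
    if "length xs = m" "\<forall>e\<in>set xs. v \<notin> e" for xs
  proof -
    have "\<not> skipped \<sigma> m es v" if "es \<in> completions A xs" for es
      using completions_nth[OF that] \<open>length xs = m\<close> \<open>\<forall>e\<in>set xs. v \<notin> e\<close>
      by (force simp: skipped_def)
    then have "cond_avg A xs (\<lambda>es. of_bool (skipped \<sigma> m es v)) = cond_avg A xs (\<lambda>_. 0)"
      by (intro cond_avg_cong) simp
    also have "\<dots> = 0" by (simp add: cond_avg_def)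
    finally show ?thesis by (simp only: mult_zero_right) (rule cond_avg_nonneg, simp)
  qed
  from fin xs assms(6,7) show ?thesis
  proof (induction xs rule: prefix_induct)
    case (full xs)
    have "length xs = m"
      using full distinct_card[of xs] m by simp
    then show ?case using base full by blast
  next
    case (snoc xs)
    show ?case
    proof (cases "length xs = m")
      case True
      then show ?thesis using base snoc by blast
    next
      case False
      then have len: "length xs < m" using snoc by simp
      have q0: "q m \<ge> 0"
        unfolding q_def using factor by (intro prod_nonneg) auto
      let ?s = "\<lambda>es. of_bool (skipped \<sigma> m es v) :: real"
      let ?l = "\<lambda>es. of_bool (skipped_leaf \<sigma> m es v) :: real"
      have "q m * cond_avg A (xs @ [e]) ?s \<le> cond_avg A (xs @ [e]) ?l" if e: "e \<in> A - set xs" for e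
      proof -
        have xse: "distinct (xs @ [e])" "set (xs @ [e]) \<subseteq> A" using snoc e by auto
        have nth: "es ! length xs = e" "\<And>i. i < length xs \<Longrightarrow> v \<notin> es ! i"
          "take (Suc (length xs)) es = xs @ [e]"
          if "es \<in> completions A (xs @ [e])" for es
          using completions_nth[OF that] completionsD(3)[OF that] snoc.prems
          by (auto simp: nth_append all_set_conv_all_nth)
        consider "v \<notin> e" | "v \<in> e" "\<sigma> (xs @ [e])" | "v \<in> e" "\<not> \<sigma> (xs @ [e])" by blast
        then show ?thesis
        proof cases
          case 1
          then show ?thesis using snoc len e by (intro snoc.IH) auto
        next
          case 2
          \<comment> \<open>A bought first edge rules out skipping for good.\<close>
          have "\<not> skipped \<sigma> m es v" if es: "es \<in> completions A (xs @ [e])" for es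
          proof
            assume "skipped \<sigma> m es v"
            then obtain j where j: "v \<in> es ! j" "\<forall>i<j. v \<notin> es ! i" "\<not> \<sigma> (take (Suc j) es)"
              by (auto simp: skipped_def)
            then have "j = length xs"
              using nth(1,2)[OF es] 2(1) by (metis linorder_neqE_nat)
            then show False using j(3) nth(3)[OF es] 2(2) by simp
          qed
          then have "cond_avg A (xs @ [e]) ?s = cond_avg A (xs @ [e]) (\<lambda>_. 0)"
            by (intro cond_avg_cong) simp
          also have "\<dots> = 0" by (simp add: cond_avg_def)
          finally show ?thesis by (simp only: mult_zero_right) (rule cond_avg_nonneg, simp)
        next
          case 3
          define D where "D = {e \<in> A. v \<in> e} - {e}"
          have eA: "e \<in> {e \<in> A. v \<in> e}" using e 3 by simp
          have cardD: "real (card D) = real d - 1" and d1: "d \<ge> 1"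
          proof -
            show "d \<ge> 1" unfolding d_def using eA fin by (auto simp: Suc_le_eq card_gt_0_iff)
            then show "real (card D) = real d - 1"
              unfolding D_def using eA by (simp add: d_def card_Diff_singleton of_nat_diff)
          qed
          have "cond_avg A (xs @ [e]) ?s \<le> cond_avg A (xs @ [e]) (\<lambda>_. 1)"
            by (intro cond_avg_mono) simp
          then have "q m * cond_avg A (xs @ [e]) ?s \<le> q m"
            using cond_avg_const[OF fin xse] q0 by (simp add: mult_left_le)
          also have "q m = (\<Prod>i<length (xs @ [e]). 1 - real d / (real (card A) - real i)) *
              (\<Prod>i\<in>{length (xs @ [e])..<m}. 1 - real d / (real (card A) - real i))"
            using len unfolding q_def lessThan_atLeast0
            by (intro prod.atLeastLessThan_concat[symmetric]) auto
          \<comment> \<open>The factors up to and including the step of \<open>e\<close> are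
            dropped, each being at most 1; in the later ones \<open>d\<close> is then lowered to
            \<open>d - 1\<close>, which only enlarges them.\<close>
          also have "\<dots> \<le> 1 * (\<Prod>i\<in>{length (xs @ [e])..<m}. 1 - real d / (real (card A) - real i))"
            using factor len by (intro mult_right_mono prod_le_1 prod_nonneg) auto
          also have "\<dots> \<le> (\<Prod>i\<in>{length (xs @ [e])..<m}. 1 - real (card D) / (real (card A) - real i))"
            unfolding mult_1
          proof (rule prod_mono, intro conjI)
            fix i assume "i \<in> {length (xs @ [e])..<m}"
            then have "i < m" by simp
            then have "real d - 1 \<le> real d" "real (card A) - real i \<ge> 0" using m by auto
            then have "(real d - 1) / (real (card A) - real i) \<le> real d / (real (card A) - real i)"
              by (rule divide_right_mono)
            then show "1 - real d / (real (card A) - real i) \<le>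
                1 - real (card D) / (real (card A) - real i)"
              unfolding cardD by linarith
            show "0 \<le> 1 - real d / (real (card A) - real i)"
              by (rule factor(1)[OF \<open>i < m\<close>])
          qed
          also have "\<dots> = cond_avg A (xs @ [e])
              (\<lambda>es. of_bool (\<forall>i\<in>{length (xs @ [e])..<m}. es ! i \<notin> D))"
          proof (rule cond_avg_avoid[OF fin xse, symmetric])
            show "D \<subseteq> A - set (xs @ [e])" using snoc.prems by (auto simp: D_def)
          qed (use len m in auto)
          also have "\<dots> \<le> cond_avg A (xs @ [e]) ?l"
          proof (rule cond_avg_mono)
            fix es assume es: "es \<in> completions A (xs @ [e])"
            have "skipped_leaf \<sigma> m es v" if avoid: "\<forall>i\<in>{length (xs @ [e])..<m}. es ! i \<notin> D"
              unfolding skipped_leaf_def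
            proof (intro exI conjI allI impI)
              show "length xs < m" by (rule len)
              show "v \<in> es ! length xs" using nth(1)[OF es] 3 by simp
              show "\<not> \<sigma> (take (Suc (length xs)) es)" using nth(3)[OF es] 3 by simp
              fix i assume i: "i < m" "i \<noteq> length xs"
              show "v \<notin> es ! i"
              proof (cases "i < length xs")
                case True
                then show ?thesis by (rule nth(2)[OF es])
              next
                case False
                then have "es ! i \<notin> D" using avoid i by simp
                moreover have "i < length es" "length xs < length es"
                  using i m len completionsD(4)[OF es] by auto
                then have "es ! i \<noteq> e" "es ! i \<in> A"
                  using i nth(1)[OF es] completionsD(1,2)[OF es]
                  by (metis nth_eq_iff_index_eq, metis nth_mem)
                ultimately show ?thesis by (simp add: D_def)
              qed
            qed
            then show "of_bool (\<forall>i\<in>{length (xs @ [e])..<m}. es ! i \<notin> D) \<le> ?l es" by simp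
          qed
          finally show ?thesis .
        qed
      qed
      then have "(\<Sum>e\<in>A - set xs. q m * cond_avg A (xs @ [e]) ?s) \<le>
          (\<Sum>e\<in>A - set xs. cond_avg A (xs @ [e]) ?l)" by (rule sum_mono)
      moreover have "real (card A) - real (length xs) \<ge> 0"
        using length_prefix_le[OF fin snoc(1,2)] by simp
      ultimately show ?thesis
        unfolding cond_avg_snoc[OF fin snoc(1-3)] times_divide_eq_right sum_distrib_left
        by (rule divide_right_mono)
    qed
  qed
qed

section \<open>The late phase\<close>

lemma card_complete_edges: "card (complete_edges n) = n choose 2"
  by (simp add: complete_edges_def)

lemma card_edges_at:
  assumes "v \<in> {1..n}"
  shows "card {e \<in> complete_edges n. v \<in> e} = n - 1"
proof -
  have "{e \<in> complete_edges n. v \<in> e} = (\<lambda>u. {u, v}) ` ({1..n} - {v})"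
    using assms by (auto simp: complete_edges_def nsets_2_eq)
  moreover have "inj_on (\<lambda>u. {u, v}) ({1..n} - {v})"
    by (auto simp: inj_on_def doubleton_eq_iff)
  ultimately show ?thesis using assms by (simp add: card_image)
qed

text \<open>Two stars of \<open>n - 1\<close> edges share exactly the edge
  \<open>{u, v}\<close>.\<close>

lemma card_edges_meeting:
  assumes "u \<in> {1..n}" "v \<in> {1..n}" "u \<noteq> v"
  shows "card {e \<in> complete_edges n. u \<in> e \<or> v \<in> e} = 2 * n - 3"
proof -
  let ?U = "{e \<in> complete_edges n. u \<in> e}" and ?V = "{e \<in> complete_edges n. v \<in> e}"
  have "e = {u, v}" if "e \<in> complete_edges n" "u \<in> e" "v \<in> e" for e
    using card_subset_eq[of e "{u, v}"] complete_edgesD[OF that(1)] that(2,3) assms(3) by simp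
  moreover have "{u, v} \<in> complete_edges n"
    unfolding complete_edges_def doubleton_in_nsets_2 using assms by simp
  ultimately have "?U \<inter> ?V = {{u, v}}" by blast
  then have "card (?U \<union> ?V) + 1 = (n - 1) + (n - 1)"
    using card_Un_Int[of ?U ?V] card_edges_at assms by simp
  moreover have "?U \<union> ?V = {e \<in> complete_edges n. u \<in> e \<or> v \<in> e}" by auto
  ultimately show ?thesis using assms by simp
qed

text \<open>The cover forces \<open>tau1\<close> to be at most \<open>m\<close>, and until
  \<open>m\<close> the only edge at \<open>v\<close> was declined.\<close>

lemma isolated_in_builder_graph:
  assumes n: "n \<ge> 2" and es: "es \<in> edge_orders n" and m: "m \<le> length es"
    and v: "v \<in> {1..n}" "skipped_leaf \<sigma> m es v"
    and cover: "{1..n} \<subseteq> \<Union>(set (take m es))"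
  shows "\<not> min_degree {1..n} (builder_graph \<sigma> es (tau1 n es)) \<ge> 1"
proof -
  have finB: "finite (builder_graph \<sigma> es (tau1 n es))"
    by (rule finite_subset[of _ "(!) es ` {..<length es}"]) (auto simp: builder_graph_def)
  have tau: "tau1 n es \<le> m" using n cover by (rule tau1_le)
  have "v \<notin> \<Union>(builder_graph \<sigma> es (tau1 n es))"
  proof
    assume "v \<in> \<Union>(builder_graph \<sigma> es (tau1 n es))"
    then obtain i where i: "i < tau1 n es" "v \<in> es ! i" "\<sigma> (take (Suc i) es)"
      by (auto simp: builder_graph_def)
    obtain j where "\<forall>i<m. i \<noteq> j \<longrightarrow> v \<notin> es ! i" "\<not> \<sigma> (take (Suc j) es)"
      using v(2) by (auto simp: skipped_leaf_def)
    then show False using i tau by (metis order_less_le_trans)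
  qed
  then show ?thesis
    using v(1) finB by (subst min_degree_ge_1_iff) auto
qed

text \<open>Builder fails when some \<open>v\<close> in \<open>W\<close> sees no edge between
  \<open>m0\<close> and \<open>m1\<close> while every vertex isolated at \<open>m0\<close> is hit.
  \<open>p\<close> is the probability of the former for one \<open>v\<close>; subtracting the pairs
  formed with at most \<open>n\<close> competing vertices gives the factor
  \<open>1 - n * p\<close>.\<close>

lemma late_failure_prob_ge:
  fixes n :: nat and xs :: "edge list" and \<sigma> :: det_strategy
  defines "K \<equiv> complete_edges n" and "m0 \<equiv> length xs"
  defines "W \<equiv> {v \<in> {1..n}. skipped_leaf \<sigma> m0 xs v}"
  assumes xs: "distinct xs" "set xs \<subseteq> K"
    and m1: "m0 \<le> m1" "m1 + 2 * n \<le> card K"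
    and n: "n \<ge> 2" "real (card K) \<le> (real n - 2)\<^sup>2"
  defines "p \<equiv> \<Prod>i\<in>{m0..<m1}. 1 - (real n - 2) / (real (card K) - real i)"
  shows "real (card W) * (p * (1 - real n * p)) \<le>
    cond_avg K xs (\<lambda>es. of_bool (\<not> min_degree {1..n} (builder_graph \<sigma> es (tau1 n es)) \<ge> 1))"
    (is "_ \<le> cond_avg K xs ?fail")
proof -
  have fin: "finite K" by (simp add: K_def)
  define D where "D v = {e \<in> K - set xs. v \<in> e}" for v
  \<comment> \<open>Revealed edges cannot recur, so avoiding the unrevealed edges \<open>D v\<close>
    means that no edge at \<open>v\<close> arrives in this period.\<close>
  define iso where "iso v es \<longleftrightarrow> (\<forall>i\<in>{m0..<m1}. es ! i \<notin> D v)" for v es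
  define U where "U = {v \<in> {1..n}. (\<forall>e\<in>set xs. v \<notin> e)}"
  have finWU: "finite W" "finite U" by (auto simp: W_def U_def)

  have deg_W: "card {e \<in> set xs. v \<in> e} = 1" if "v \<in> W" for v
  proof -
    obtain j where "j < m0" "v \<in> xs ! j" "\<forall>i<m0. i \<noteq> j \<longrightarrow> v \<notin> xs ! i"
      using \<open>v \<in> W\<close> by (auto simp: W_def skipped_leaf_def)
    then have "{e \<in> set xs. v \<in> e} = {xs ! j}"
      unfolding m0_def set_conv_nth by blast
    then show ?thesis by simp
  qed
  have deg_U: "card {e \<in> set xs. v \<in> e} = 0" if "v \<in> U" for v
    using that by (auto simp: U_def)

  have card_D: "card (D v) = n - 2" if v: "v \<in> W" for v
  proof -
    have "D v = {e \<in> K. v \<in> e} - {e \<in> set xs. v \<in> e}"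
      by (auto simp: D_def)
    then have "card (D v) = card {e \<in> K. v \<in> e} - card {e \<in> set xs. v \<in> e}"
      using xs by (simp only:) (intro card_Diff_subset, auto)
    then show ?thesis
      using card_edges_at[of v n] deg_W[OF v] v by (simp add: K_def W_def)
  qed
  \<comment> \<open>Of the \<open>2 * n - 3\<close> edges meeting \<open>v\<close> or
    \<open>z\<close>, at most two are revealed: one at \<open>v\<close> and at most one at
    \<open>z\<close>.\<close>
  have card_D2: "2 * n - 5 \<le> card (D v \<union> D z)" if v: "v \<in> W" and z: "z \<in> U \<union> W" "z \<noteq> v" for v z
  proof -
    let ?x = "{e \<in> set xs. v \<in> e \<or> z \<in> e}"
    have "D v \<union> D z = {e \<in> K. v \<in> e \<or> z \<in> e} - ?x"
      by (auto simp: D_def)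
    then have "card (D v \<union> D z) = card {e \<in> K. v \<in> e \<or> z \<in> e} - card ?x"
      using xs by (simp only:) (intro card_Diff_subset, auto)
    also have "card {e \<in> K. v \<in> e \<or> z \<in> e} = 2 * n - 3"
      unfolding K_def using v z by (intro card_edges_meeting) (auto simp: W_def U_def)
    finally have "card (D v \<union> D z) = 2 * n - 3 - card ?x" .
    moreover have "card ?x \<le> 2"
    proof -
      have "?x = {e \<in> set xs. v \<in> e} \<union> {e \<in> set xs. z \<in> e}" by blast
      then have "card ?x = card ({e \<in> set xs. v \<in> e} \<union> {e \<in> set xs. z \<in> e})"
        by (rule arg_cong)
      also have "\<dots> \<le> card {e \<in> set xs. v \<in> e} + card {e \<in> set xs. z \<in> e}"
        by (rule card_Un_le)
      finally have "card ?x \<le> card {e \<in> set xs. v \<in> e} + card {e \<in> set xs. z \<in> e}" .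
      moreover have "card {e \<in> set xs. z \<in> e} \<le> 1"
        using z(1)
      proof
        assume "z \<in> U"
        then show ?thesis using deg_U[of z] by linarith
      next
        assume "z \<in> W"
        then show ?thesis using deg_W[of z] by linarith
      qed
      ultimately show ?thesis using deg_W[OF v] by linarith
    qed
    ultimately show ?thesis by simp
  qed

  have prob1: "cond_avg K xs (\<lambda>es. of_bool (iso v es)) = p" if v: "v \<in> W" for v
  proof -
    have "cond_avg K xs (\<lambda>es. of_bool (iso v es)) =
        (\<Prod>i\<in>{length xs..<m1}. 1 - real (card (D v)) / (real (card K) - real i))"
      unfolding iso_def m0_def using m1 by (intro cond_avg_avoid[OF fin xs]) (auto simp: D_def m0_def)
    also have "\<dots> = p"
      unfolding p_def m0_def card_D[OF v] using n by (simp add: of_nat_diff)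
    finally show ?thesis .
  qed
  have prob2: "cond_avg K xs (\<lambda>es. of_bool (iso v es \<and> iso z es)) \<le> p\<^sup>2"
    if v: "v \<in> W" and z: "z \<in> U \<union> W" "z \<noteq> v" for v z
  proof -
    let ?D = "D v \<union> D z"
    have "cond_avg K xs (\<lambda>es. of_bool (iso v es \<and> iso z es)) =
        cond_avg K xs (\<lambda>es. of_bool (\<forall>i\<in>{length xs..<m1}. es ! i \<notin> ?D))"
      by (rule arg_cong[where f = "cond_avg K xs"]) (auto simp: iso_def m0_def fun_eq_iff)
    also have "\<dots> = (\<Prod>i\<in>{length xs..<m1}. 1 - real (card ?D) / (real (card K) - real i))"
      using m1 by (intro cond_avg_avoid[OF fin xs]) (auto simp: D_def m0_def)
    also have "\<dots> \<le> (\<Prod>i\<in>{m0..<m1}. (1 - (real n - 2) / (real (card K) - real i))\<^sup>2)"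
      unfolding m0_def[symmetric]
    proof (rule prod_mono, intro conjI)
      fix i assume "i \<in> {m0..<m1}"
      \<comment> \<open>\<open>m1 + 2 * n \<le> card K\<close> keeps this denominator at least
        \<open>2 * n\<close>, so the factors are nonnegative;
        \<open>card K \<le> (n - 2)\<^sup>2\<close> bounds it from above.\<close>
      define x where "x = real (card K) - real i"
      have x: "x \<ge> 2 * real n" "x > 0" "x \<le> (real n - 2)\<^sup>2"
        using \<open>i \<in> _\<close> m1 n by (auto simp: x_def)
      have "card ?D \<le> card {e \<in> K. v \<in> e \<or> z \<in> e}"
        using fin by (intro card_mono) (auto simp: D_def)
      also have "\<dots> = 2 * n - 3"
        unfolding K_def using v z by (intro card_edges_meeting) (auto simp: W_def U_def)
      finally have "real (card ?D) \<le> x" using x n by linarith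
      then show "0 \<le> 1 - real (card ?D) / (real (card K) - real i)"
        unfolding x_def[symmetric] using x by (simp add: divide_le_eq)
      have "2 * n \<le> card ?D + 5"
        using card_D2[OF v z] by simp
      then have "real (2 * n) \<le> real (card ?D + 5)"
        by (rule of_nat_mono)
      then have "2 * (real n - 2) - 1 \<le> real (card ?D)" by simp
      then have "1 - real (card ?D) / x \<le> 1 - (2 * (real n - 2) - 1) / x"
        using x by (simp add: divide_right_mono)
      also have "\<dots> = 1 - 2 * (real n - 2) / x + 1 / x"
        by (simp add: diff_divide_distrib)
      \<comment> \<open>The possible edge between \<open>v\<close> and \<open>z\<close> costs the term \<open>1 / x\<close>, which the square absorbs.\<close>
      also have "1 / x \<le> (real n - 2)\<^sup>2 / x\<^sup>2"
        using x by (simp add: field_simps power2_eq_square)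
      also have "1 - 2 * (real n - 2) / x + (real n - 2)\<^sup>2 / x\<^sup>2 = (1 - (real n - 2) / x)\<^sup>2"
        unfolding power2_diff power_divide by simp
      finally show "1 - real (card ?D) / (real (card K) - real i) \<le>
          (1 - (real n - 2) / (real (card K) - real i))\<^sup>2"
        unfolding x_def by simp
    qed
    also have "\<dots> = p\<^sup>2" by (simp add: p_def prod_power_distrib)
    finally show ?thesis .
  qed

  \<comment> \<open>Bonferroni: the left-hand side is \<open>|T| (2 - |Z|)\<close>, positive only if \<open>T = Z\<close> is a singleton.\<close>
  have pointwise: "(\<Sum>v\<in>W. of_bool (iso v es)) -
      (\<Sum>v\<in>W. \<Sum>z\<in>(U \<union> W) - {v}. of_bool (iso v es \<and> iso z es)) \<le> ?fail es"
    if es: "es \<in> completions K xs" for es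
  proof -
    define T where "T = {v \<in> W. iso v es}"
    define Z where "Z = {z \<in> U \<union> W. iso z es}"
    have finTZ: "finite T" "finite Z" "T \<subseteq> Z" using finWU by (auto simp: T_def Z_def)
    have "(\<Sum>v\<in>W. of_bool (iso v es)) = real (card T)"
      using finWU by (simp add: T_def sum_of_bool_eq Int_def)
    moreover have "(\<Sum>v\<in>W. \<Sum>z\<in>(U \<union> W) - {v}. of_bool (iso v es \<and> iso z es)) =
        real (card T) * (real (card Z) - 1)"
    proof -
      have "(\<Sum>z\<in>(U \<union> W) - {v}. of_bool (iso v es \<and> iso z es)) =
          (if iso v es then real (card Z) - 1 else 0)" if v: "v \<in> W" for v
      proof (cases "iso v es")
        case True
        have "((U \<union> W) - {v}) \<inter> {z. iso z es} = Z - {v}" by (auto simp: Z_def)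
        moreover have "v \<in> Z" using True v by (simp add: Z_def)
        moreover have "card Z \<ge> 1" using \<open>v \<in> Z\<close> finTZ by (auto simp: Suc_le_eq card_gt_0_iff)
        ultimately show ?thesis
          using True finWU finTZ by (simp add: sum_of_bool_eq of_nat_diff)
      qed simp
      then have "(\<Sum>v\<in>W. \<Sum>z\<in>(U \<union> W) - {v}. of_bool (iso v es \<and> iso z es)) =
          (\<Sum>v\<in>W. if iso v es then real (card Z) - 1 else 0)" by (rule sum.cong[OF refl])
      also have "\<dots> = (\<Sum>v\<in>T. real (card Z) - 1)"
        unfolding T_def using finWU by (intro sum.inter_filter[symmetric]) auto
      finally show ?thesis by simp
    qed
    moreover have "real (card T) - real (card T) * (real (card Z) - 1) \<le> ?fail es"
    proof (cases "T = {} \<or> card Z \<ge> 2")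
      case True
      have "real (card T) * (2 - real (card Z)) \<le> 0"
        using True by (auto simp: mult_le_0_iff)
      then show ?thesis by (simp add: algebra_simps)
    next
      case False
      then obtain v where v: "v \<in> T" by blast
      have "card Z \<ge> card T" "card T \<ge> 1"
        using finTZ v by (auto simp: card_mono Suc_le_eq card_gt_0_iff)
      then have card1: "card T = 1" "card Z = 1" using False by auto
      then have "Z = {v}" using v finTZ(3) by (auto simp: card_1_singleton_iff)
      note D = completionsD[OF es]
      have vW: "v \<in> W" "iso v es" using v by (auto simp: T_def)
      have len: "m1 \<le> length es" "m0 \<le> length es" using m1 D(4) by auto
      have nthK: "es ! i \<in> K - set xs" if i: "i < length es" "m0 \<le> i" for i
      proof -
        have "es ! i \<notin> set (take m0 es)"
        proof
          assume "es ! i \<in> set (take m0 es)"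
          then obtain j where "j < m0" "j < length es" "es ! j = es ! i"
            by (auto simp: in_set_conv_nth)
          then show False using i D(1) by (simp add: nth_eq_iff_index_eq)
        qed
        then show ?thesis using D(2,3) i nth_mem[of i es] by (simp add: m0_def)
      qed
      have notin: "v \<notin> es ! i" if "m0 \<le> i" "i < m1" for i
        using vW(2) nthK[of i] that len by (auto simp: iso_def D_def)
      have leaf: "skipped_leaf \<sigma> m1 es v"
      proof -
        obtain j where j: "j < m0" "v \<in> xs ! j" "\<forall>i<m0. i \<noteq> j \<longrightarrow> v \<notin> xs ! i"
            "\<not> \<sigma> (take (Suc j) xs)"
          using vW(1) by (auto simp: W_def skipped_leaf_def)
        have "take (Suc j) es = take (Suc j) xs"
          using D(3) j(1) by (metis Suc_leI m0_def min.absorb1 take_take)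
        moreover have "es ! i = xs ! i" if "i < m0" for i
          using completions_nth[OF es] that by (simp add: m0_def)
        ultimately show ?thesis
          unfolding skipped_leaf_def using j notin m1(1)
          by (intro exI[of _ j]) (metis linorder_not_le order_less_le_trans)
      qed
      \<comment> \<open>Vertices of \<open>U\<close> differ from \<open>v\<close> and are hit before
        \<open>m1\<close>, because \<open>Z = {v}\<close>; all others were touched before
        \<open>m0\<close>.\<close>
      have cover: "{1..n} \<subseteq> \<Union>(set (take m1 es))"
      proof
        fix u assume u: "u \<in> {1..n}"
        have sub: "es ! i \<in> set (take m1 es)" if "i < m1" for i
          using that len by (auto simp: in_set_conv_nth)
        show "u \<in> \<Union>(set (take m1 es))"
        proof (cases "u \<in> U")
          case True
          have "u \<noteq> v" using deg_U[OF True] deg_W[OF vW(1)] by (metis zero_neq_one)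
          then have "\<not> iso u es" using True \<open>Z = {v}\<close> by (auto simp: Z_def)
          then show ?thesis using sub by (auto simp: iso_def D_def)
        next
          case False
          then obtain e where e: "e \<in> set xs" "u \<in> e" using u by (auto simp: U_def)
          have "set xs = set (take m0 es)" using D(3) by (simp add: m0_def)
          also have "\<dots> \<subseteq> set (take m1 es)" using m1(1) by (rule set_take_subset_set_take)
          finally show ?thesis using e by blast
        qed
      qed
      have "es \<in> edge_orders n"
        using D by (simp add: edge_orders_def permutations_of_set_def K_def)
      then have "\<not> min_degree {1..n} (builder_graph \<sigma> es (tau1 n es)) \<ge> 1"
        using n len leaf cover vW by (intro isolated_in_builder_graph) (auto simp: W_def)
      then show ?thesis using card1 by simp
    qed
    ultimately show ?thesis by simp
  qed

  have "real (card W) * (p * (1 - real n * p)) = real (card W) * p - real (card W) * (real n * p\<^sup>2)"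
    by (simp add: algebra_simps power2_eq_square)
  also have "\<dots> \<le> (\<Sum>v\<in>W. cond_avg K xs (\<lambda>es. of_bool (iso v es))) -
      (\<Sum>v\<in>W. \<Sum>z\<in>(U \<union> W) - {v}. cond_avg K xs (\<lambda>es. of_bool (iso v es \<and> iso z es)))"
  proof (intro diff_mono)
    show "real (card W) * p \<le> (\<Sum>v\<in>W. cond_avg K xs (\<lambda>es. of_bool (iso v es)))"
      using prob1 by simp
    have "(\<Sum>z\<in>(U \<union> W) - {v}. cond_avg K xs (\<lambda>es. of_bool (iso v es \<and> iso z es))) \<le> real n * p\<^sup>2"
      if v: "v \<in> W" for v
    proof -
      have "(\<Sum>z\<in>(U \<union> W) - {v}. cond_avg K xs (\<lambda>es. of_bool (iso v es \<and> iso z es))) \<le>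
          (\<Sum>z\<in>(U \<union> W) - {v}. p\<^sup>2)"
        using prob2[OF v] by (intro sum_mono) auto
      also have "\<dots> = real (card ((U \<union> W) - {v})) * p\<^sup>2" by simp
      also have "card ((U \<union> W) - {v}) \<le> card {1..n}"
        by (intro card_mono) (auto simp: U_def W_def)
      finally show ?thesis by (simp add: mult_right_mono)
    qed
    then have "(\<Sum>v\<in>W. \<Sum>z\<in>(U \<union> W) - {v}. cond_avg K xs (\<lambda>es. of_bool (iso v es \<and> iso z es))) \<le>
        (\<Sum>v\<in>W. real n * p\<^sup>2)" by (rule sum_mono)
    then show "(\<Sum>v\<in>W. \<Sum>z\<in>(U \<union> W) - {v}. cond_avg K xs (\<lambda>es. of_bool (iso v es \<and> iso z es))) \<le>
        real (card W) * (real n * p\<^sup>2)" by simp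
  qed
  also have "\<dots> = cond_avg K xs (\<lambda>es. (\<Sum>v\<in>W. of_bool (iso v es)) -
      (\<Sum>v\<in>W. \<Sum>z\<in>(U \<union> W) - {v}. of_bool (iso v es \<and> iso z es)))"
    by (simp add: cond_avg_diff cond_avg_sum)
  also have "\<dots> \<le> cond_avg K xs ?fail"
    by (rule cond_avg_mono) (rule pointwise)
  finally show ?thesis .
qed

section \<open>Choice of times and averaging\<close>

text \<open>The product starts at 1 and each factor is at least \<open>1 / 2\<close>, so when it
  first drops to \<open>c\<close> it is still at least \<open>c / 2\<close>. Each factor is at most
  \<open>exp (- d / N)\<close>, so \<open>N div 4\<close> steps suffice to reach
  \<open>exp (- d / 5)\<close>.\<close>

lemma exists_decay_time:
  fixes N a :: nat and c d :: real
  defines "f \<equiv> \<lambda>m. \<Prod>i\<in>{a..<m}. 1 - d / (real N - real i)"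
  assumes N: "20 \<le> N" "4 * a \<le> N" "0 \<le> d" "4 * d \<le> real N"
    and c: "exp (- d / 5) \<le> c" "c < 1"
  shows "\<exists>m\<ge>a. m \<le> a + N div 4 \<and> c / 2 \<le> f m \<and> f m \<le> c"
proof -
  define L where "L = N div 4"
  \<comment> \<open>Passing from a quarter to a fifth absorbs the rounding in
    \<open>N div 4\<close>, as \<open>N\<close> is at least 20.\<close>
  have L: "real N / 5 \<le> real L" "4 * L \<le> N" using N by (auto simp: L_def)
  have bounds: "1 / 2 \<le> 1 - d / (real N - real i)" "1 - d / (real N - real i) \<le> exp (- d / real N)"
    if "i < a + L" for i
  proof -
    have x: "real N / 2 \<le> real N - real i" "0 < real N - real i"
      using that N L by auto
    then have "d / (real N - real i) \<le> d / (real N / 2)"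
      using N by (intro divide_left_mono) auto
    also have "\<dots> \<le> 1 / 2" using N by (simp add: field_simps)
    finally show "1 / 2 \<le> 1 - d / (real N - real i)" by simp
    have "d / real N \<le> d / (real N - real i)"
      using N x by (intro divide_left_mono) auto
    then have "1 - d / (real N - real i) \<le> 1 + - d / real N" by simp
    also have "\<dots> \<le> exp (- d / real N)" by (rule exp_ge_add_one_self)
    finally show "1 - d / (real N - real i) \<le> exp (- d / real N)" .
  qed
  have "f (a + L) \<le> (\<Prod>i\<in>{a..<a + L}. exp (- d / real N))"
    unfolding f_def
  proof (rule prod_mono, intro conjI)
    fix i assume "i \<in> {a..<a + L}"
    then have "i < a + L" by simp
    note b = bounds[OF this]
    show "0 \<le> 1 - d / (real N - real i)" using b(1) by linarith
    show "1 - d / (real N - real i) \<le> exp (- d / real N)" by (rule b(2))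
  qed
  also have "\<dots> = exp (real L * (- d / real N))"
    unfolding exp_of_nat_mult by simp
  also have "\<dots> \<le> exp (- d / 5)"
  proof -
    have "d * (real N / 5) \<le> d * real L" using L N by (intro mult_left_mono) auto
    then show ?thesis using N by (simp add: field_simps)
  qed
  finally have stop: "f (a + L) \<le> c" using c by linarith
  \<comment> \<open>The first crossing of \<open>c\<close>; it is not at the start, where the empty
    product is 1.\<close>
  define k where "k = (LEAST k. f (a + k) \<le> c)"
  have k: "f (a + k) \<le> c" unfolding k_def using stop by (rule LeastI)
  have "k \<le> L" unfolding k_def using stop by (rule Least_le)
  have "k \<noteq> 0"
  proof
    assume "k = 0"
    then have "f (a + k) = 1" by (simp add: f_def)
    then show False using k c by linarith
  qed
  then obtain j where j: "k = Suc j" using not0_implies_Suc by blast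
  have "\<not> f (a + j) \<le> c" using j unfolding k_def by (metis lessI not_less_Least)
  moreover have "f (a + k) = f (a + j) * (1 - d / (real N - real (a + j)))"
    by (simp add: f_def j)
  moreover have "1 / 2 \<le> 1 - d / (real N - real (a + j))"
    using bounds(1)[of "a + j"] j \<open>k \<le> L\<close> by simp
  moreover have "c \<ge> 0" using c(1) exp_ge_zero[of "- d / 5"] by linarith
  ultimately have "c * (1 / 2) \<le> f (a + k)"
    by (simp only:) (intro mult_mono, auto)
  then show ?thesis
    using k \<open>k \<le> L\<close> by (intro exI[of _ "a + k"]) (auto simp: L_def)
qed

text \<open>The event is decided by the first \<open>m\<close> edges, so the set of skipped leaves
  is fixed once these are revealed.\<close>

lemma skipped_leaf_take: "skipped_leaf \<sigma> m (take m es) v \<longleftrightarrow> skipped_leaf \<sigma> m es v"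
  by (simp add: skipped_leaf_def Suc_leI min.absorb1 cong: conj_cong)

text \<open>The expectation of the count in \<open>card_skipped_ge\<close>: each vertex is isolated
  with the product probability, and each edge leads the \<open>2 * n - 3\<close> edges meeting it,
  itself included, with probability \<open>1 / (2 * n - 3)\<close>.\<close>

lemma expected_skipped_ge:
  fixes n m :: nat and \<sigma> :: det_strategy and b :: real
  defines "K \<equiv> complete_edges n"
  assumes n: "n \<ge> 2" and m: "m \<le> card K"
    and budget: "\<And>es. es \<in> edge_orders n \<Longrightarrow> real (card (builder_graph \<sigma> es (tau1 n es))) \<le> b"
  shows "real n - real n * (\<Prod>i<m. 1 - (real n - 1) / (real (card K) - real i))
      - real (card K) / (2 * real n - 3) - b
    \<le> cond_avg K [] (\<lambda>es. real (card {v \<in> {1..n}. skipped \<sigma> m es v}))"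
proof -
  have fin: "finite K" by (simp add: K_def)
  have nil: "distinct ([] :: edge list)" "set ([] :: edge list) \<subseteq> K" by auto
  let ?I = "\<lambda>es. \<Sum>v\<in>{1..n}. of_bool (\<forall>i<m. v \<notin> es ! i) :: real"
  let ?touch = "\<lambda>e. {f \<in> K. f \<inter> e \<noteq> {}}"
  let ?D = "\<lambda>es. \<Sum>e\<in>K. of_bool (leads es e (?touch e)) :: real"
  have "cond_avg K [] ?I = real n * (\<Prod>i<m. 1 - (real n - 1) / (real (card K) - real i))"
  proof -
    have "cond_avg K [] (\<lambda>es. of_bool (\<forall>i<m. v \<notin> es ! i)) =
        (\<Prod>i<m. 1 - (real n - 1) / (real (card K) - real i))" if v: "v \<in> {1..n}" for v
    proof -
      have "cond_avg K [] (\<lambda>es. of_bool (\<forall>i<m. v \<notin> es ! i)) =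
          cond_avg K [] (\<lambda>es. of_bool (\<forall>i\<in>{length ([] :: edge list)..<m}. es ! i \<notin> {e \<in> K. v \<in> e}))"
      proof (rule cond_avg_cong)
        fix es assume es: "es \<in> completions K []"
        have "es ! i \<in> K" if "i < m" for i
          using completionsD(2,4)[OF es] m that nth_mem[of i es] by simp
        then show "of_bool (\<forall>i<m. v \<notin> es ! i) = (of_bool
            (\<forall>i\<in>{length ([] :: edge list)..<m}. es ! i \<notin> {e \<in> K. v \<in> e}) :: real)"
          by auto
      qed
      also have "\<dots> = (\<Prod>i\<in>{length ([] :: edge list)..<m}.
          1 - real (card {e \<in> K. v \<in> e}) / (real (card K) - real i))"
        using m by (intro cond_avg_avoid[OF fin nil]) auto
      also have "\<dots> = (\<Prod>i<m. 1 - (real n - 1) / (real (card K) - real i))"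
        using card_edges_at[OF v] n by (simp add: K_def lessThan_atLeast0 of_nat_diff)
      finally show ?thesis .
    qed
    then show ?thesis by (simp add: cond_avg_sum del: sum_of_bool_eq)
  qed
  moreover have "cond_avg K [] ?D = real (card K) / (2 * real n - 3)"
  proof -
    have "cond_avg K [] (\<lambda>es. of_bool (leads es e (?touch e))) = 1 / (2 * real n - 3)"
      if e: "e \<in> K" for e
    proof -
      obtain u v where uv: "e = {u, v}" "u \<noteq> v"
        using complete_edgesD(2)[of e n] e by (auto simp: K_def card_2_iff)
      then have uv': "u \<in> {1..n}" "v \<in> {1..n}"
        using complete_edgesD(1)[of e n] e by (auto simp: K_def)
      have "?touch e = {f \<in> complete_edges n. u \<in> f \<or> v \<in> f}"
        unfolding uv(1) K_def by blast
      then have "card (?touch e) = 2 * n - 3"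
        using card_edges_meeting[OF uv' uv(2)] by simp
      moreover have "cond_avg K [] (\<lambda>es. of_bool (leads es e (?touch e))) = 1 / real (card (?touch e))"
        unfolding leads_def using e uv by (intro cond_avg_first[OF fin nil]) auto
      ultimately show ?thesis using n by (simp add: of_nat_diff)
    qed
    then show ?thesis by (simp add: cond_avg_sum del: sum_of_bool_eq)
  qed
  moreover have "cond_avg K [] (\<lambda>es. real n - b - ?I es - ?D es) \<le>
      cond_avg K [] (\<lambda>es. real (card {v \<in> {1..n}. skipped \<sigma> m es v}))"
  proof (rule cond_avg_mono)
    fix es assume es: "es \<in> completions K []"
    then have eo: "es \<in> edge_orders n" by (simp add: completions_Nil edge_orders_def K_def)
    have "real n \<le> real (card {v \<in> {1..n}. skipped \<sigma> m es v} + card {v \<in> {1..n}. \<forall>i<m. v \<notin> es ! i}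
        + card {e \<in> K. leads es e (?touch e)} + card (builder_graph \<sigma> es (tau1 n es)))"
      unfolding of_nat_le_iff K_def using m completionsD(4)[OF es]
      by (intro card_skipped_ge[OF n eo]) simp
    moreover have "?I es = real (card {v \<in> {1..n}. \<forall>i<m. v \<notin> es ! i})"
      by (simp add: sum_of_bool_eq Int_def)
    moreover have "?D es = real (card {e \<in> K. leads es e (?touch e)})"
      using fin by (simp add: sum_of_bool_eq Int_def)
    ultimately show "real n - b - ?I es - ?D es \<le> real (card {v \<in> {1..n}. skipped \<sigma> m es v})"
      using budget[OF eo] by simp
  qed
  ultimately show ?thesis
    using cond_avg_const[OF fin nil] by (simp add: cond_avg_diff)
qed

text \<open>Linearity over the vertices, starting from the empty history, where every vertex has all
  its \<open>n - 1\<close> edges unrevealed.\<close>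

lemma expected_skipped_leaf_ge:
  fixes n m :: nat and \<sigma> :: det_strategy
  defines "K \<equiv> complete_edges n"
  assumes m: "m + n \<le> card K"
  shows "(\<Prod>i<m. 1 - (real n - 1) / (real (card K) - real i)) *
      cond_avg K [] (\<lambda>es. real (card {v \<in> {1..n}. skipped \<sigma> m es v}))
    \<le> cond_avg K [] (\<lambda>es. real (card {v \<in> {1..n}. skipped_leaf \<sigma> m es v}))"
proof -
  have fin: "finite K" by (simp add: K_def)
  let ?q = "\<Prod>i<m. 1 - (real n - 1) / (real (card K) - real i)"
  have as_sum: "(\<lambda>es. real (card {v \<in> {1..n}. P es v})) = (\<lambda>es. \<Sum>v\<in>{1..n}. of_bool (P es v))"
    for P :: "edge list \<Rightarrow> nat \<Rightarrow> bool"
    by (simp add: sum_of_bool_eq Int_def)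
  have "?q * cond_avg K [] (\<lambda>es. of_bool (skipped \<sigma> m es v)) \<le>
      cond_avg K [] (\<lambda>es. of_bool (skipped_leaf \<sigma> m es v))" if v: "v \<in> {1..n}" for v
  proof -
    have "card {e \<in> K. v \<in> e} = n - 1" unfolding K_def using v by (rule card_edges_at)
    moreover from this have "m + card {e \<in> K. v \<in> e} \<le> card K" using m by simp
    ultimately show ?thesis
      using prob_skipped_leaf_ge[of K "[]" v m \<sigma>] fin v by (simp add: of_nat_diff)
  qed
  then show ?thesis
    unfolding as_sum cond_avg_sum sum_distrib_left by (rule sum_mono)
qed

text \<open>The bookkeeping: \<open>q\<close> lies between \<open>\<epsilon> / 4\<close> and
  \<open>\<epsilon> / 2\<close>, at least \<open>\<epsilon> n / 4\<close> vertices are skipped and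
  \<open>\<epsilon>\<^sup>2 n / 16\<close> are skipped leaves in expectation, and each contributes
  at least \<open>1 / (8 n)\<close> to the failure probability.\<close>

lemma eventually_det_failure_prob_ge:
  fixes \<epsilon> :: real
  assumes \<epsilon>: "0 < \<epsilon>" "\<epsilon> \<le> 3 / 4"
  shows "\<forall>\<^sub>F n in sequentially. \<forall>\<sigma>.
    (\<forall>es\<in>edge_orders n. real (card (builder_graph \<sigma> es (tau1 n es))) \<le> (3 / 4 - \<epsilon>) * real n) \<longrightarrow>
    \<epsilon> ^ 3 / 100 \<le> cond_avg (complete_edges n) []
      (\<lambda>es. of_bool (\<not> min_degree {1..n} (builder_graph \<sigma> es (tau1 n es)) \<ge> 1))"
proof -
  have "\<forall>\<^sub>F n :: nat in sequentially. exp (- (real n - 2) / 5) \<le> 1 / (2 * real n)"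
    by real_asymp
  moreover have "\<forall>\<^sub>F n :: nat in sequentially. exp (- (real n - 2) / 5) \<le> \<epsilon> / 2"
    using \<epsilon> by real_asymp
  moreover have "\<forall>\<^sub>F n :: nat in sequentially. 4 \<le> \<epsilon> * real n"
    using \<epsilon> by real_asymp
  moreover have "\<forall>\<^sub>F n :: nat in sequentially. 20 \<le> n"
    by (rule eventually_ge_at_top)
  ultimately show ?thesis
  proof eventually_elim
    case (elim n)
    define K where "K = complete_edges n"
    have fin: "finite K" by (simp add: K_def)
    have nil: "distinct ([] :: edge list)" "set ([] :: edge list) \<subseteq> K" by auto
    have n: "real n \<ge> 20" using elim by simp
    have N: "real (card K) = real n * (real n - 1) / 2"
      using elim(4) by (simp add: K_def card_complete_edges choose_two real_of_nat_div of_nat_diff)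
    have N_ge: "real (card K) \<ge> 9 * real n"
      unfolding N using n by (simp add: mult_left_mono)
    have N_le: "real (card K) \<le> (real n - 2)\<^sup>2"
    proof -
      define y where "y = real n * real n"
      have "y \<ge> 20 * real n" unfolding y_def using n by (intro mult_right_mono) auto
      moreover have "(real n - 2)\<^sup>2 = y - 4 * real n + 4"
        by (simp add: y_def power2_eq_square algebra_simps)
      moreover have "real (card K) = (y - real n) / 2"
        unfolding N by (simp add: y_def algebra_simps)
      ultimately show ?thesis using n by simp
    qed
    have "exp (- (real n - 1) / 5) \<le> exp (- (real n - 2) / 5)" by simp
    then have "exp (- (real n - 1) / 5) \<le> \<epsilon> / 2" using elim by linarith
    then obtain m0 where m0: "m0 \<le> card K div 4"
        "\<epsilon> / 4 \<le> (\<Prod>i<m0. 1 - (real n - 1) / (real (card K) - real i))"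
        "(\<Prod>i<m0. 1 - (real n - 1) / (real (card K) - real i)) \<le> \<epsilon> / 2"
      using exists_decay_time[of "card K" 0 "real n - 1" "\<epsilon> / 2"] N_ge n \<epsilon>
      by (auto simp: lessThan_atLeast0)
    define q where "q = (\<Prod>i<m0. 1 - (real n - 1) / (real (card K) - real i))"
    have "4 * m0 \<le> card K" using m0(1) by linarith
    \<comment> \<open>The rate is \<open>n - 2\<close> because a leaf has used one of its edges. The
      target \<open>1 / (2 n)\<close> maximises \<open>p * (1 - n * p)\<close>; the possible loss of
      a factor 2 in \<open>p\<close> still leaves \<open>1 / (8 n)\<close>.\<close>
    then obtain m1 where m1: "m0 \<le> m1" "m1 \<le> m0 + card K div 4"
        "1 / (2 * real n) / 2 \<le> (\<Prod>i\<in>{m0..<m1}. 1 - (real n - 2) / (real (card K) - real i))"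
        "(\<Prod>i\<in>{m0..<m1}. 1 - (real n - 2) / (real (card K) - real i)) \<le> 1 / (2 * real n)"
      using exists_decay_time[of "card K" m0 "real n - 2" "1 / (2 * real n)"] N_ge n m0 elim
      by auto
    define p where "p = (\<Prod>i\<in>{m0..<m1}. 1 - (real n - 2) / (real (card K) - real i))"
    have p: "1 / (8 * real n) \<le> p * (1 - real n * p)"
    proof -
      have p_ge: "1 / (4 * real n) \<le> p" and "p \<le> 1 / (2 * real n)"
        using m1(3,4) by (simp_all add: p_def)
      then have "1 / 2 \<le> 1 - real n * p"
        using n by (simp add: field_simps)
      moreover have "0 \<le> p"
        by (rule order_trans[OF _ p_ge]) simp
      ultimately have "1 / (4 * real n) * (1 / 2) \<le> p * (1 - real n * p)"
        using p_ge by (intro mult_mono) auto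
      then show ?thesis by simp
    qed
    have m1': "m1 + 2 * n \<le> card K" using m0(1) m1(2) N_ge by linarith
    have ratio: "real (card K) / (2 * real n - 3) \<le> real n / 4 + 1"
      unfolding N using n by (simp add: field_simps)

    show ?case
    proof (intro allI impI)
      fix \<sigma>
      assume budget: "\<forall>es\<in>edge_orders n.
        real (card (builder_graph \<sigma> es (tau1 n es))) \<le> (3 / 4 - \<epsilon>) * real n"
      let ?fail = "\<lambda>es. of_bool (\<not> min_degree {1..n} (builder_graph \<sigma> es (tau1 n es)) \<ge> 1) :: real"
      define S where "S = cond_avg K [] (\<lambda>es. real (card {v \<in> {1..n}. skipped \<sigma> m0 es v}))"
      define W where "W = cond_avg K [] (\<lambda>es. real (card {v \<in> {1..n}. skipped_leaf \<sigma> m0 es v}))"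
      have "real n - real n * q - real (card K) / (2 * real n - 3) - (3 / 4 - \<epsilon>) * real n \<le> S"
        unfolding S_def q_def K_def
        using elim(4) m0(1) budget by (intro expected_skipped_ge) (auto simp: K_def)
      moreover have "real n * q \<le> real n * (\<epsilon> / 2)"
        using m0(3) by (intro mult_left_mono) (auto simp: q_def)
      \<comment> \<open>From \<open>\<epsilon> n\<close>, isolated vertices take at most one half
        and the additive 1 in \<open>ratio\<close> at most one quarter, by
        \<open>4 \<le> \<epsilon> n\<close>.\<close>
      ultimately have "\<epsilon> / 4 * real n \<le> S"
        using ratio elim(3) by (simp add: algebra_simps)
      then have "\<epsilon> / 4 * (\<epsilon> / 4 * real n) \<le> q * S"
        using m0(2) \<epsilon> by (intro mult_mono) (auto simp: q_def)
      also have "q * S \<le> W"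
        unfolding q_def S_def W_def K_def using m1(1) m1'
        by (intro expected_skipped_leaf_ge) (simp add: K_def)
      finally have W: "\<epsilon>\<^sup>2 / 16 * real n \<le> W" by (simp add: power2_eq_square)

      \<comment> \<open>This uses \<open>\<epsilon> \<le> 3 / 4\<close>, which is below
        \<open>100 / 128\<close>.\<close>
      have "\<epsilon> ^ 3 / 100 \<le> \<epsilon>\<^sup>2 / 128"
        using \<epsilon> by (simp add: power2_eq_square power3_eq_cube)
      also have "\<dots> = 1 / (8 * real n) * (\<epsilon>\<^sup>2 / 16 * real n)"
        using n by simp
      also have "\<dots> \<le> (p * (1 - real n * p)) * W"
        using p W n by (intro mult_mono) (auto intro: order_trans[rotated])
      also have "\<dots> = cond_avg K [] (\<lambda>es. p * (1 - real n * p) *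
          real (card {v \<in> {1..n}. skipped_leaf \<sigma> m0 es v}))"
        unfolding W_def by (rule cond_avg_cmult[symmetric])
      \<comment> \<open>The late-phase bound is applied to every history of length
        \<open>m0\<close>; the tower property then removes the conditioning.\<close>
      also have "\<dots> \<le> cond_avg K [] (\<lambda>es. cond_avg K (take m0 es) ?fail)"
      proof (rule cond_avg_mono)
        fix es assume es: "es \<in> completions K []"
        note D = completionsD[OF es]
        have len: "length (take m0 es) = m0" using D(4) m0(1) by simp
        have "distinct (take m0 es)" "set (take m0 es) \<subseteq> complete_edges n"
          using D(1,2) set_take_subset[of m0 es] by (auto simp: K_def)
        from late_failure_prob_ge[OF this, of m1 \<sigma>, unfolded len skipped_leaf_take]
        show "p * (1 - real n * p) * real (card {v \<in> {1..n}. skipped_leaf \<sigma> m0 es v})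
            \<le> cond_avg K (take m0 es) ?fail"
          using m1(1) m1' elim(4) N_le by (simp add: K_def p_def mult.commute)
      qed
      also have "\<dots> = cond_avg K [] ?fail"
        using m0(1) by (intro cond_avg_tower[OF fin nil]) auto
      finally show "\<epsilon> ^ 3 / 100 \<le> cond_avg (complete_edges n) [] ?fail"
        unfolding K_def .
    qed
  qed
qed

section \<open>From averages to probabilities and randomised strategies\<close>

lemma prob_graph_process:
  "measure_pmf.prob (graph_process n) {es. P es} = cond_avg (complete_edges n) [] (\<lambda>es. of_bool (P es))"
proof -
  have "measure_pmf.prob (graph_process n) {es. P es} =
      real (card (edge_orders n \<inter> {es. P es})) / real (card (edge_orders n))"
    unfolding graph_process_def by (rule measure_pmf_of_set) (auto simp: edge_orders_def)
  then show ?thesis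
    by (simp add: cond_avg_def completions_Nil edge_orders_def sum_of_bool_eq)
qed

text \<open>A randomised strategy is a mixture of deterministic ones drawn independently of the
  order, so a bound holding for each of them survives averaging.\<close>

lemma failure_prob_ge:
  assumes "c \<ge> 0"
    and det: "\<And>\<sigma>. \<sigma> \<in> set_pmf S \<Longrightarrow>
      c \<le> measure_pmf.prob (graph_process n) {es. \<not> P (builder_graph \<sigma> es (t es))}"
  shows "c \<le> failure_prob n t P S"
proof -
  let ?X = "{(es, \<sigma>). \<not> P (builder_graph \<sigma> es (t es))}"
  have "ennreal c = (\<integral>\<^sup>+\<sigma>. ennreal c \<partial>measure_pmf S)"
    by (simp add: measure_pmf.emeasure_space_1)
  also have "\<dots> \<le> (\<integral>\<^sup>+\<sigma>. (\<integral>\<^sup>+es. indicator ?X (es, \<sigma>) \<partial>measure_pmf (graph_process n)) \<partial>measure_pmf S)"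
  proof (rule nn_integral_mono_AE, unfold AE_measure_pmf_iff, intro ballI)
    fix \<sigma> assume "\<sigma> \<in> set_pmf S"
    have "(\<lambda>es. indicator ?X (es, \<sigma>) :: ennreal) =
        indicator {es. \<not> P (builder_graph \<sigma> es (t es))}"
      by (auto simp: fun_eq_iff indicator_def)
    then have "(\<integral>\<^sup>+es. indicator ?X (es, \<sigma>) \<partial>measure_pmf (graph_process n)) =
        ennreal (measure_pmf.prob (graph_process n) {es. \<not> P (builder_graph \<sigma> es (t es))})"
      by (simp add: measure_pmf.emeasure_eq_measure)
    then show "ennreal c \<le> (\<integral>\<^sup>+es. indicator ?X (es, \<sigma>) \<partial>measure_pmf (graph_process n))"
      using det[OF \<open>\<sigma> \<in> set_pmf S\<close>] by (simp add: ennreal_leI)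
  qed
  \<comment> \<open>The components are swapped so that the strategy is drawn in the outer
    integral.\<close>
  also have "\<dots> = (\<integral>\<^sup>+z. indicator ?X z \<partial>measure_pmf (pair_pmf (graph_process n) S))"
    by (subst pair_commute_pmf)
       (simp add: nn_integral_pair_pmf' case_prod_unfold)
  also have "\<dots> = ennreal (failure_prob n t P S)"
    by (simp add: failure_prob_def measure_pmf.emeasure_eq_measure)
  finally show ?thesis
    by (simp add: failure_prob_def)
qed

theorem theorem1p3:
  fixes \<epsilon> :: real
  assumes "\<epsilon> > 0"
  shows "\<forall>\<^sub>F n in sequentially. \<forall>S. tb_strategy n (tau1 n) ((3 / 4 - \<epsilon>) * real n) S \<longrightarrow>
           failure_prob n (tau1 n) (\<lambda>B. min_degree {1..n} B \<ge> 1) S \<ge> \<epsilon> ^ 3 / 100"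
proof (cases "\<epsilon> \<le> 3 / 4")
  case True
  show ?thesis
    using eventually_det_failure_prob_ge[OF assms True]
  proof eventually_elim
    case (elim n)
    show ?case
    proof (intro allI impI)
      fix S assume "tb_strategy n (tau1 n) ((3 / 4 - \<epsilon>) * real n) S"
      then show "\<epsilon> ^ 3 / 100 \<le> failure_prob n (tau1 n) (\<lambda>B. min_degree {1..n} B \<ge> 1) S"
        using assms elim
        by (intro failure_prob_ge) (auto simp: tb_strategy_def prob_graph_process)
    qed
  qed
next
  case False
  \<comment> \<open>For \<open>\<epsilon> > 3 / 4\<close> the budget is negative and the claim is
    vacuous; a strategy in the support and an edge order exist to witness this.\<close>
  have "\<not> tb_strategy n (tau1 n) ((3 / 4 - \<epsilon>) * real n) S" if n: "n > 0" for n S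
  proof
    assume tb: "tb_strategy n (tau1 n) ((3 / 4 - \<epsilon>) * real n) S"
    obtain \<sigma> where "\<sigma> \<in> set_pmf S" using set_pmf_not_empty[of S] by blast
    moreover have "edge_orders n \<noteq> {}" by (simp add: edge_orders_def)
    then obtain es where "es \<in> edge_orders n" by blast
    ultimately have "real (card (builder_graph \<sigma> es (tau1 n es))) \<le> (3 / 4 - \<epsilon>) * real n"
      using tb by (simp add: tb_strategy_def)
    moreover have "(3 / 4 - \<epsilon>) * real n < 0"
      using False n by (simp add: mult_neg_pos)
    ultimately show False by linarith
  qed
  then show ?thesis
    by (intro eventually_mono[OF eventually_gt_at_top[of 0]]) blast
qed

end
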